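(* Let $S\subset\mathbb{N}^p$ be an affine semigroup whose cone $\mathcal{C}_S$ has extremal rays $\tau_1,\ldots,\tau_t$, and let $M=\{m_1,\ldots,m_t\}\subset S$ be such that $M\cap(\tau_i\setminus\{0\})\neq\emptyset$ for every $i\in\{1,\ldots,t\}$. Consider the ideal $M+S$ of $S$. Then the $I(S)$-semigroup $T=(M+S)\cup\{0\}$ is a MED-semigroup. Moreover, $$\mathcal{H}(T)=\mathcal{H}(S)\sqcup\Big(\bigcap_{i=1}^t\mathrm{Ap}(S,m_i)\setminus\{0\}\Big).$$
   Context: $\mathbb{N}$ contains $0$, and $p\ge 1$. An affine semigroup $S\subseteq\mathbb{N}^p$ is a finitely generated submonoid of $(\mathbb{N}^p,+)$ (containing $0$). An ideal of $S$ is a subset $P\subseteq S$ with $P+S\subseteq P$; an affine semigroup $T$ is an $I(S)$-semigroup if $T\setminus\{0\}$ is an ideal of $S$. For an affine semigroup $S$, $\mathcal{C}_S$ is the set of non-negative rational linear combinations of elements of $S$, intersected with $\mathbb{N}^p$; its extremal rays are the one-dimensional faces of the rational cone generated by $S$ (intersected with $\mathbb{N}^p$), and $\mathcal{H}(S)=\mathcal{C}_S\setminus S$ is the set of gaps. The $i$-multiplicity $\mathrm{mult}_i(S)$ is the minimum non-zero element of $\tau_i\cap S$ for the componentwise partial order. The Apery set of $S$ with respect to $m\in S$ is $\mathrm{Ap}(S,m)=\{s\in S\mid s-m\notin S\}$. An affine semigroup $T$ with extremal rays $\tau_1,\ldots,\tau_t$ of $\mathcal{C}_T$, minimally generated by $E\sqcup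 A$ with $E=\{e_1,\ldots,e_t\}$, $e_i=\mathrm{mult}_i(T)$, is a MED-semigroup if $\bigcap_{i=1}^t\mathrm{Ap}(T,e_i)=A\sqcup\{0\}$. *)

theory Defs
  imports "HOL-Analysis.Analysis" "HOL-Library.Set_Algebras"
begin

definition submonoid_pred :: "(nat ^ 'p::finite) set \<Rightarrow> bool" where
  "submonoid_pred S \<longleftrightarrow> 0 \<in> S \<and> (\<forall>x\<in>S. \<forall>y\<in>S. x + y \<in> S)"

definition affine_semigroup :: "(nat ^ 'p::finite) set \<Rightarrow> bool" where
  "affine_semigroup S \<longleftrightarrow> submonoid_pred S \<and> (\<exists>G. finite G \<and> S = submonoid_pred hull G)"

definition semigroup_ideal :: "(nat ^ 'p::finite) set \<Rightarrow> (nat ^ 'p) set \<Rightarrow> bool" where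
  "semigroup_ideal P S \<longleftrightarrow> P \<subseteq> S \<and> P + S \<subseteq> P"

definition I_semigroup :: "(nat ^ 'p::finite) set \<Rightarrow> (nat ^ 'p) set \<Rightarrow> bool" where
  "I_semigroup S T \<longleftrightarrow> affine_semigroup T \<and> semigroup_ideal (T - {0}) S"

definition rat_vec :: "nat ^ 'p::finite \<Rightarrow> rat ^ 'p" where
  "rat_vec x = (\<chi> i. of_nat (x $ i))"

definition rat_cone :: "(nat ^ 'p::finite) set \<Rightarrow> (rat ^ 'p) set" where
  "rat_cone S = {x. \<exists>F c. finite F \<and> F \<subseteq> S \<and> (\<forall>s\<in>F. 0 \<le> c s) \<and> x = (\<Sum>s\<in>F. c s *s rat_vec s)}"

definition lattice_cone :: "(nat ^ 'p::finite) set \<Rightarrow> (nat ^ 'p) set" where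
  "lattice_cone S = {x. rat_vec x \<in> rat_cone S}"

text \<open>Faces of a convex cone over the rationals; the library's \<open>face_of\<close> is available over the
  reals only. For convex cones, the segment condition in \<open>face_of\<close> amounts to the condition on
  sums below.\<close>

definition cone_face :: "(rat ^ 'p::finite) set \<Rightarrow> (rat ^ 'p) set \<Rightarrow> bool" where
  "cone_face F K \<longleftrightarrow> F \<subseteq> K \<and>
     0 \<in> F \<and> (\<forall>x\<in>F. \<forall>y\<in>F. x + y \<in> F) \<and> (\<forall>c x. 0 \<le> c \<and> x \<in> F \<longrightarrow> c *s x \<in> F) \<and>
     (\<forall>x\<in>K. \<forall>y\<in>K. x + y \<in> F \<longrightarrow> x \<in> F \<and> y \<in> F)"

definition extremal_rays :: "(nat ^ 'p::finite) set \<Rightarrow> (nat ^ 'p) set set" where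
  "extremal_rays S = {{x. rat_vec x \<in> F} | F. cone_face F (rat_cone S) \<and> vec.dim F = 1}"

definition gaps :: "(nat ^ 'p::finite) set \<Rightarrow> (nat ^ 'p) set" where
  "gaps S = lattice_cone S - S"

text \<open>The order on \<open>nat ^ 'p\<close> is componentwise, so \<open>LEAST\<close> denotes the minimum in that order.\<close>

definition mult :: "(nat ^ 'p::finite) set \<Rightarrow> (nat ^ 'p) set \<Rightarrow> nat ^ 'p" where
  "mult S \<tau> = (LEAST x. x \<in> \<tau> \<inter> S - {0})"

text \<open>The condition \<open>s - m \<notin> S\<close> refers to the difference in the group of integer vectors, whereas
  subtraction on \<open>nat\<close> truncates; hence the additive form.\<close>

definition Apery :: "(nat ^ 'p::finite) set \<Rightarrow> nat ^ 'p \<Rightarrow> (nat ^ 'p) set" where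
  "Apery S m = {s \<in> S. \<not> (\<exists>u\<in>S. s = u + m)}"

definition minimally_generated_by :: "(nat ^ 'p::finite) set \<Rightarrow> (nat ^ 'p) set \<Rightarrow> bool" where
  "minimally_generated_by T G \<longleftrightarrow>
     submonoid_pred hull G = T \<and> (\<forall>G'. G' \<subset> G \<longrightarrow> submonoid_pred hull G' \<noteq> T)"

text \<open>The intersection of Apery sets is taken inside \<open>T\<close>: this only matters for \<open>T = {0}\<close>, which
  has no extremal rays, since an empty intersection is \<open>UNIV\<close> in HOL.\<close>

definition MED_semigroup :: "(nat ^ 'p::finite) set \<Rightarrow> bool" where
  "MED_semigroup T \<longleftrightarrow> affine_semigroup T \<and>
     (\<exists>E A. E = mult T ` extremal_rays T \<and> E \<inter> A = {} \<and> minimally_generated_by T (E \<union> A) \<and>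
        0 \<notin> A \<and> T \<inter> (\<Inter>\<tau>\<in>extremal_rays T. Apery T (mult T \<tau>)) = A \<union> {0})"

end

theory Submission
  imports Defs
begin

text \<open>A generating set of the rational cone of \<open>S\<close> that is minimal under inclusion consists of
  vectors spanning one-dimensional faces, because the cone lies in the non-negative orthant. Hence
  \<open>M\<close>, which meets all extremal rays, generates the same cone as \<open>S\<close>, and every element of \<open>S\<close> has
  a positive multiple in \<open>T\<close>. This bounds the coefficients in atoms of \<open>T\<close>, so \<open>T\<close> is finitely
  generated. By the face property the element of \<open>M\<close> on a ray is the least non-zero element of \<open>T\<close>
  on it, and a non-zero element of \<open>T\<close> is a sum of two non-zero ones iff it lies in \<open>M + (M + S)\<close>.\<close>

section \<open>Submonoids and atoms\<close>

lemma add_eq_0_vec_iff: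
  fixes x y :: "nat ^ 'p::finite"
  shows "x + y = 0 \<longleftrightarrow> x = 0 \<and> y = 0"
  by (auto simp: vec_eq_iff)

lemma submonoid_pred_hull: "submonoid_pred (submonoid_pred hull G)"
  by (rule hull_in) (auto simp: submonoid_pred_def)

lemma submonoid_pred_smult:
  assumes "submonoid_pred T" "x \<in> T"
  shows "n *s x \<in> T"
proof (induction n)
  case 0
  then show ?case using assms by (simp add: submonoid_pred_def)
next
  case (Suc n)
  have "Suc n *s x = x + n *s x" by (simp add: vec_eq_iff)
  then show ?case using Suc assms by (simp add: submonoid_pred_def)
qed

lemma submonoid_pred_sum:
  assumes "submonoid_pred T" "\<And>x. x \<in> G \<Longrightarrow> f x \<in> T"
  shows "(\<Sum>x\<in>G. f x) \<in> T"
  using assms by (induction G rule: infinite_finite_induct) (auto simp: submonoid_pred_def)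

text \<open>The sums with natural coefficients contain \<open>G\<close>, are closed under addition,
  and lie in every submonoid containing \<open>G\<close>. This coefficient form is what later gets
  bounded for atoms.\<close>

lemma submonoid_pred_hull_finite:
  assumes "finite G"
  shows "submonoid_pred hull G = range (\<lambda>b. \<Sum>g\<in>G. b g *s g)"
proof (rule hull_unique)
  show "G \<subseteq> range (\<lambda>b. \<Sum>g\<in>G. b g *s g)"
  proof
    fix g assume "g \<in> G"
    have "(\<Sum>h\<in>G. (if h = g then 1 else 0) *s h) = (\<Sum>h\<in>G. if h = g then h else 0)"
      by (rule sum.cong) (auto simp: vec_eq_iff)
    then have "g = (\<Sum>h\<in>G. (if h = g then 1 else 0) *s h)"
      using assms \<open>g \<in> G\<close> by simp
    then show "g \<in> range (\<lambda>b. \<Sum>g\<in>G. b g *s g)" by (rule range_eqI[where x = "\<lambda>h. if h = g then 1 else 0"])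
  qed
  show "submonoid_pred (range (\<lambda>b. \<Sum>g\<in>G. b g *s g))"
    unfolding submonoid_pred_def
  proof (intro conjI ballI)
    show "0 \<in> range (\<lambda>b. \<Sum>g\<in>G. b g *s g)"
      by (rule range_eqI[where x = "\<lambda>_. 0"]) simp
    fix x y assume "x \<in> range (\<lambda>b. \<Sum>g\<in>G. b g *s g)" "y \<in> range (\<lambda>b. \<Sum>g\<in>G. b g *s g)"
    then obtain b c where "x = (\<Sum>g\<in>G. b g *s g)" "y = (\<Sum>g\<in>G. c g *s g)"
      by (elim rangeE)
    then show "x + y \<in> range (\<lambda>b. \<Sum>g\<in>G. b g *s g)"
      by (intro range_eqI[where x = "\<lambda>g. b g + c g"]) (simp add: sum.distrib)
  qed
  show "range (\<lambda>b. \<Sum>g\<in>G. b g *s g) \<subseteq> T" if "G \<subseteq> T" "submonoid_pred T" for T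
    using that by (auto intro!: submonoid_pred_sum submonoid_pred_smult)
qed

text \<open>These are the irreducible elements of a monoid without non-zero units. They will serve
  as its minimal generating set, the Hilbert basis.\<close>

definition atoms :: "(nat ^ 'p::finite) set \<Rightarrow> (nat ^ 'p) set" where
  "atoms T = {x \<in> T - {0}. \<forall>y\<in>T. \<forall>z\<in>T. x = y + z \<longrightarrow> y = 0 \<or> z = 0}"

text \<open>Both parts of a proper decomposition have a strictly smaller coordinate sum, so
  splitting an element repeatedly ends in atoms.\<close>

lemma submonoid_pred_hull_atoms:
  fixes T :: "(nat ^ 'p::finite) set"
  assumes "submonoid_pred T"
  shows "submonoid_pred hull (atoms T) = T"
proof (rule antisym)
  show "submonoid_pred hull (atoms T) \<subseteq> T"
    by (rule hull_minimal) (auto simp: atoms_def assms)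
  show "T \<subseteq> submonoid_pred hull (atoms T)"
  proof
    fix x assume "x \<in> T"
    then show "x \<in> submonoid_pred hull (atoms T)"
    proof (induction "\<Sum>i\<in>UNIV. x $ i" arbitrary: x rule: less_induct)
      case less
      consider "x = 0" | "x \<in> atoms T"
        | y z where "y \<in> T" "z \<in> T" "x = y + z" "y \<noteq> 0" "z \<noteq> 0"
        using less.prems by (auto simp: atoms_def)
      then show ?case
      proof cases
        case 1
        then show ?thesis using submonoid_pred_hull by (auto simp: submonoid_pred_def)
      next
        case 2
        then show ?thesis by (rule hull_inc)
      next
        case 3
        have "(\<Sum>i\<in>UNIV. y $ i) > 0" "(\<Sum>i\<in>UNIV. z $ i) > 0"
          using 3 by (auto simp: vec_eq_iff intro!: Nat.gr0I)
        then have "(\<Sum>i\<in>UNIV. y $ i) < (\<Sum>i\<in>UNIV. x $ i)"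
            "(\<Sum>i\<in>UNIV. z $ i) < (\<Sum>i\<in>UNIV. x $ i)"
          by (auto simp: 3 sum.distrib)
        then show ?thesis using less.hyps 3 submonoid_pred_hull
          by (metis submonoid_pred_def)
      qed
    qed
  qed
qed

text \<open>Removing an atom \<open>a\<close> from \<open>T\<close> leaves a submonoid, since
  \<open>a\<close> is not a sum of two other elements. A generating set inside \<open>T\<close>
  therefore cannot omit \<open>a\<close>.\<close>

lemma minimally_generated_by_atoms:
  fixes T :: "(nat ^ 'p::finite) set"
  assumes T: "submonoid_pred T"
  shows "minimally_generated_by T (atoms T)"
  unfolding minimally_generated_by_def
proof (intro conjI allI impI notI submonoid_pred_hull_atoms T)
  fix G assume G: "G \<subset> atoms T" and hull: "submonoid_pred hull G = T"
  then obtain a where a: "a \<in> atoms T" "a \<notin> G" by blast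
  have "submonoid_pred (T - {a})"
    using a T by (auto simp: submonoid_pred_def atoms_def)
  moreover have "G \<subseteq> T - {a}" using G a by (auto simp: atoms_def)
  ultimately have "T \<subseteq> T - {a}" using hull by (metis hull_minimal)
  then show False using a by (auto simp: atoms_def)
qed

section \<open>Rational cones\<close>

lemma rat_vec_nth [simp]: "rat_vec x $ i = of_nat (x $ i)"
  by (simp add: rat_vec_def)

lemma rat_vec_0 [simp]: "rat_vec 0 = 0"
  by (simp add: vec_eq_iff)

lemma rat_vec_add: "rat_vec (x + y) = rat_vec x + rat_vec y"
  by (simp add: vec_eq_iff)

lemma rat_vec_smult: "rat_vec (n *s x) = of_nat n *s rat_vec x"
  by (simp add: vec_eq_iff)

lemma rat_vec_eq_iff [simp]: "rat_vec x = rat_vec y \<longleftrightarrow> x = y"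
  by (simp add: vec_eq_iff)

lemma rat_vec_eq_0_iff [simp]: "rat_vec x = 0 \<longleftrightarrow> x = 0"
  by (simp add: vec_eq_iff)

definition rat_convex_cone :: "(rat ^ 'p::finite) set \<Rightarrow> bool" where
  "rat_convex_cone K \<longleftrightarrow>
     0 \<in> K \<and> (\<forall>x\<in>K. \<forall>y\<in>K. x + y \<in> K) \<and> (\<forall>c x. 0 \<le> c \<and> x \<in> K \<longrightarrow> c *s x \<in> K)"

lemma rat_convex_cone_sum:
  assumes K: "rat_convex_cone K" and "\<And>s. s \<in> F \<Longrightarrow> f s \<in> K"
  shows "(\<Sum>s\<in>F. f s) \<in> K"
  using assms(2)
proof (induction F rule: infinite_finite_induct)
  case (insert s F)
  then have "f s \<in> K" "sum f F \<in> K" by simp_all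
  then show ?case using K insert.hyps by (simp add: rat_convex_cone_def)
qed (use K in \<open>simp_all add: rat_convex_cone_def\<close>)

lemma rat_coneE:
  assumes "x \<in> rat_cone S"
  obtains F c where "finite F" "F \<subseteq> S" "\<forall>s\<in>F. 0 \<le> c s" "x = (\<Sum>s\<in>F. c s *s rat_vec s)"
  using assms unfolding rat_cone_def by (elim CollectE exE conjE) (rule that)

text \<open>This acts as an induction principle: to show a property on all of
  \<open>rat_cone S\<close>, take for \<open>K\<close> the set of vectors having it.\<close>

lemma rat_cone_minimal:
  assumes K: "rat_convex_cone K" and S: "\<And>s. s \<in> S \<Longrightarrow> rat_vec s \<in> K"
  shows "rat_cone S \<subseteq> K"
proof
  fix x assume "x \<in> rat_cone S"
  then obtain F c where F: "F \<subseteq> S" "\<forall>s\<in>F. 0 \<le> c s" "x = (\<Sum>s\<in>F. c s *s rat_vec s)"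
    by (rule rat_coneE)
  have "c s *s rat_vec s \<in> K" if "s \<in> F" for s
  proof -
    have "rat_vec s \<in> K" "0 \<le> c s" using that F S by auto
    then show ?thesis using K by (simp add: rat_convex_cone_def)
  qed
  then show "x \<in> K" unfolding F(3) by (rule rat_convex_cone_sum[OF K])
qed

lemma rat_convex_cone_rat_cone: "rat_convex_cone (rat_cone S)"
proof -
  have "0 \<in> rat_cone S"
    unfolding rat_cone_def by (intro CollectI exI[of _ "{}"]) simp
  moreover have "x + y \<in> rat_cone S" if xy: "x \<in> rat_cone S" "y \<in> rat_cone S" for x y
  proof -
    obtain F c where F: "finite F" "F \<subseteq> S" "\<forall>s\<in>F. 0 \<le> c s" "x = (\<Sum>s\<in>F. c s *s rat_vec s)"
      using xy(1) by (rule rat_coneE)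
    obtain H d where H: "finite H" "H \<subseteq> S" "\<forall>s\<in>H. 0 \<le> d s" "y = (\<Sum>s\<in>H. d s *s rat_vec s)"
      using xy(2) by (rule rat_coneE)
    \<comment> \<open>Both coefficient functions are extended by zero to the common index set
      \<open>F \<union> H\<close>, where they can be added.\<close>
    define e where "e s = (if s \<in> F then c s else 0) + (if s \<in> H then d s else 0)" for s
    have "x = (\<Sum>s\<in>F\<union>H. (if s \<in> F then c s else 0) *s rat_vec s)"
      unfolding F(4) using F(1) H(1) by (intro sum.mono_neutral_cong_left) auto
    moreover have "y = (\<Sum>s\<in>F\<union>H. (if s \<in> H then d s else 0) *s rat_vec s)"
      unfolding H(4) using F(1) H(1) by (intro sum.mono_neutral_cong_left) auto
    ultimately have "x + y = (\<Sum>s\<in>F\<union>H. e s *s rat_vec s)"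
      by (simp add: e_def vector_sadd_rdistrib sum.distrib)
    moreover have "\<forall>s\<in>F\<union>H. 0 \<le> e s" using F(3) H(3) by (auto simp: e_def)
    ultimately show ?thesis
      unfolding rat_cone_def using F(1,2) H(1,2)
      by (intro CollectI exI[of _ "F \<union> H"] exI[of _ e]) auto
  qed
  moreover have "a *s x \<in> rat_cone S" if a: "0 \<le> a" and x: "x \<in> rat_cone S" for a x
  proof -
    obtain F c where F: "finite F" "F \<subseteq> S" "\<forall>s\<in>F. 0 \<le> c s" "x = (\<Sum>s\<in>F. c s *s rat_vec s)"
      using x by (rule rat_coneE)
    have "a *s x = (\<Sum>s\<in>F. (a * c s) *s rat_vec s)"
      by (simp add: F(4) vec_eq_iff sum_distrib_left mult.assoc)
    then show ?thesis
      unfolding rat_cone_def using F a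
      by (intro CollectI exI[of _ F] exI[of _ "\<lambda>s. a * c s"]) auto
  qed
  ultimately show ?thesis by (simp add: rat_convex_cone_def)
qed

lemma rat_cone_inc:
  assumes "s \<in> S"
  shows "rat_vec s \<in> rat_cone S"
  unfolding rat_cone_def using assms
  by (intro CollectI exI[of _ "{s}"] exI[of _ "\<lambda>_. 1"]) auto

lemma rat_cone_mono: "S \<subseteq> S' \<Longrightarrow> rat_cone S \<subseteq> rat_cone S'"
  by (rule rat_cone_minimal[OF rat_convex_cone_rat_cone]) (blast intro: rat_cone_inc)

text \<open>The lattice points of a convex cone form a submonoid, so passing from \<open>G\<close>
  to its hull adds nothing to the cone.\<close>

lemma rat_cone_hull: "rat_cone (submonoid_pred hull G) = rat_cone G"
proof (rule antisym)
  have "submonoid_pred {x. rat_vec x \<in> rat_cone G}"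
    using rat_convex_cone_rat_cone[of G]
    by (auto simp: submonoid_pred_def rat_convex_cone_def rat_vec_add)
  then have "submonoid_pred hull G \<subseteq> {x. rat_vec x \<in> rat_cone G}"
    by (intro hull_minimal) (auto intro: rat_cone_inc)
  then show "rat_cone (submonoid_pred hull G) \<subseteq> rat_cone G"
    by (intro rat_cone_minimal[OF rat_convex_cone_rat_cone]) blast
  show "rat_cone G \<subseteq> rat_cone (submonoid_pred hull G)"
    by (rule rat_cone_mono[OF hull_subset])
qed

text \<open>The half-space where coordinate \<open>i\<close> is non-negative is a convex cone
  containing all generators. This replaces any separate argument that the cone is pointed.\<close>

lemma rat_cone_nonneg:
  assumes "x \<in> rat_cone S"
  shows "0 \<le> x $ i"
proof -
  have "rat_cone S \<subseteq> {x. 0 \<le> x $ i}"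
    by (rule rat_cone_minimal) (auto simp: rat_convex_cone_def)
  with assms show ?thesis by blast
qed

lemma rat_cone_finiteE:
  assumes "finite G" "x \<in> rat_cone G"
  obtains c where "\<forall>s. 0 \<le> c s" "x = (\<Sum>s\<in>G. c s *s rat_vec s)"
proof -
  obtain F c where F: "finite F" "F \<subseteq> G" "\<forall>s\<in>F. 0 \<le> c s" "x = (\<Sum>s\<in>F. c s *s rat_vec s)"
    using assms(2) by (rule rat_coneE)
  have "x = (\<Sum>s\<in>G. (if s \<in> F then c s else 0) *s rat_vec s)"
    unfolding F(4) using F(2) assms(1) by (intro sum.mono_neutral_cong_left) auto
  then show thesis using F(3) by (intro that[of "\<lambda>s. if s \<in> F then c s else 0"]) auto
qed

text \<open>Denominators are cleared: the rational vectors with a positive integer multiple in the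
  hull form a convex cone containing \<open>M\<close>, hence containing
  \<open>rat_cone M\<close>.\<close>

lemma lattice_cone_multiple:
  assumes "x \<in> lattice_cone M"
  obtains k where "k > 0" "k *s x \<in> submonoid_pred hull M"
proof -
  define H where "H = submonoid_pred hull M"
  have H: "submonoid_pred H" unfolding H_def by (rule submonoid_pred_hull)
  define K where "K = {v. \<exists>k>0. \<exists>y\<in>H. of_nat k *s v = rat_vec y}"
  have "0 \<in> K"
    unfolding K_def using H by (auto simp: submonoid_pred_def intro!: exI[of _ 1] bexI[of _ 0])
  moreover have "v + w \<in> K" if v: "v \<in> K" and w: "w \<in> K" for v w
  proof -
    obtain k y where k: "k > 0" "y \<in> H" "of_nat k *s v = rat_vec y"
      using v unfolding K_def by (elim CollectE exE bexE conjE)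
    obtain l z where l: "l > 0" "z \<in> H" "of_nat l *s w = rat_vec z"
      using w unfolding K_def by (elim CollectE exE bexE conjE)
    have "of_nat (k * l) *s (v + w) = of_nat l *s (of_nat k *s v) + of_nat k *s (of_nat l *s w)"
      by (simp add: vec_eq_iff algebra_simps)
    also have "\<dots> = rat_vec (l *s y + k *s z)"
      by (simp add: k l rat_vec_add rat_vec_smult)
    finally have "of_nat (k * l) *s (v + w) = rat_vec (l *s y + k *s z)" .
    moreover have "l *s y + k *s z \<in> H"
      using H k l submonoid_pred_smult[OF H] by (auto simp: submonoid_pred_def)
    ultimately show ?thesis
      unfolding K_def using k(1) l(1) by (intro CollectI exI[of _ "k * l"]) auto
  qed
  moreover have "c *s v \<in> K" if c: "0 \<le> c" and v: "v \<in> K" for c v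
  proof -
    obtain k y where k: "k > 0" "y \<in> H" "of_nat k *s v = rat_vec y"
      using v unfolding K_def by (elim CollectE exE bexE conjE)
    \<comment> \<open>The reduced fraction has a positive denominator, and \<open>0 \<le> c\<close>
      makes its numerator non-negative, so \<open>nat\<close> changes neither value.\<close>
    obtain a b where ab: "b > 0" "c = of_nat a / of_nat b"
    proof -
      obtain a b where ab: "quotient_of c = (a, b)" by fastforce
      then have b: "b > 0" "c = of_int a / of_int b"
        by (auto simp: quotient_of_denom_pos quotient_of_div)
      then have "a \<ge> 0" using c by (simp add: zero_le_divide_iff)
      with b show thesis by (intro that[of "nat b" "nat a"]) auto
    qed
    have "of_nat (b * k) *s (c *s v) = of_nat a *s (of_nat k *s v)"
      using ab by (simp add: vec_eq_iff)
    also have "\<dots> = rat_vec (a *s y)" by (simp add: k rat_vec_smult)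
    finally show ?thesis
      unfolding K_def using k ab(1) submonoid_pred_smult[OF H]
      by (intro CollectI exI[of _ "b * k"]) auto
  qed
  ultimately have "rat_convex_cone K" by (simp add: rat_convex_cone_def)
  moreover have "rat_vec s \<in> K" if "s \<in> M" for s
    unfolding K_def H_def using that
    by (intro CollectI exI[of _ 1]) (auto intro: hull_inc)
  ultimately have "rat_cone M \<subseteq> K" by (rule rat_cone_minimal)
  then obtain k y where "k > 0" "y \<in> H" "of_nat k *s rat_vec x = rat_vec y"
    using assms unfolding lattice_cone_def K_def by blast
  then show thesis using that[of k] by (simp add: H_def flip: rat_vec_smult)
qed

section \<open>Extremal rays\<close>

lemma extremal_rays_cong: "rat_cone S = rat_cone T \<Longrightarrow> extremal_rays S = extremal_rays T"
  by (simp add: extremal_rays_def)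

lemma extremal_rays_addD:
  assumes "\<tau> \<in> extremal_rays S" "x \<in> S" "y \<in> S" "x + y \<in> \<tau>"
  shows "x \<in> \<tau>" "y \<in> \<tau>"
proof -
  obtain F where F: "cone_face F (rat_cone S)" "\<tau> = {x. rat_vec x \<in> F}"
    using assms(1) by (auto simp: extremal_rays_def)
  have "rat_vec x \<in> rat_cone S" "rat_vec y \<in> rat_cone S" "rat_vec x + rat_vec y \<in> F"
    using assms F(2) by (auto intro: rat_cone_inc simp: rat_vec_add)
  then have "rat_vec x \<in> F \<and> rat_vec y \<in> F"
    using F(1) unfolding cone_face_def by blast
  then show "x \<in> \<tau>" "y \<in> \<tau>" using F by auto
qed

text \<open>Dimension one makes \<open>x\<close> a scalar multiple of \<open>v\<close>. The sign is
  read off at a coordinate where \<open>v\<close> is non-zero, because both vectors are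
  non-negative.\<close>

lemma dim_1_face_subset:
  assumes F: "cone_face F (rat_cone S)" "vec.dim F = 1"
    and v: "v \<in> F" "v \<noteq> 0" and x: "x \<in> F"
  obtains c where "0 \<le> c" "x = c *s v"
proof -
  have "vec.independent {v}" using v by simp
  then have "F \<subseteq> vec.span {v}"
    using v F by (intro vec.card_ge_dim_independent) auto
  then obtain c where c: "x = c *s v" using x by (auto simp: vec.span_singleton)
  obtain i where i: "v $ i \<noteq> 0" using v by (auto simp: vec_eq_iff)
  have "0 \<le> v $ i" "0 \<le> x $ i"
    using F v x rat_cone_nonneg by (auto simp: cone_face_def)
  with i c have "0 \<le> c" by (simp add: zero_le_mult_iff)
  then show thesis using c by (rule that)
qed

text \<open>Each of the two faces consists of the non-negative multiples of the common point
  \<open>x\<close>.\<close>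

lemma extremal_rays_unique:
  assumes "\<tau> \<in> extremal_rays S" "\<tau>' \<in> extremal_rays S" "x \<in> \<tau>" "x \<in> \<tau>'" "x \<noteq> 0"
  shows "\<tau> = \<tau>'"
proof -
  obtain F where F: "cone_face F (rat_cone S)" "vec.dim F = 1" "\<tau> = {x. rat_vec x \<in> F}"
    using assms(1) by (auto simp: extremal_rays_def)
  obtain F' where F': "cone_face F' (rat_cone S)" "vec.dim F' = 1" "\<tau>' = {x. rat_vec x \<in> F'}"
    using assms(2) by (auto simp: extremal_rays_def)
  have x: "rat_vec x \<in> F" "rat_vec x \<in> F'" "rat_vec x \<noteq> 0" using assms F F' by auto
  have "y \<in> F'" if "y \<in> F" for y
    using dim_1_face_subset[OF F(1,2) x(1,3) that] F'(1) x(2) unfolding cone_face_def by metis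
  moreover have "y \<in> F" if "y \<in> F'" for y
    using dim_1_face_subset[OF F'(1,2) x(2,3) that] F(1) x(1) unfolding cone_face_def by metis
  ultimately show ?thesis using F F' by blast
qed

section \<open>Irredundant generators span extremal rays\<close>

lemma cone_faceI:
  assumes "F \<subseteq> K" "0 \<in> F" "\<And>x y. x \<in> F \<Longrightarrow> y \<in> F \<Longrightarrow> x + y \<in> F"
    and "\<And>c x. 0 \<le> c \<Longrightarrow> x \<in> F \<Longrightarrow> c *s x \<in> F"
    and "\<And>x y. x \<in> K \<Longrightarrow> y \<in> K \<Longrightarrow> x + y \<in> F \<Longrightarrow> x \<in> F \<and> y \<in> F"
  shows "cone_face F K"
  unfolding cone_face_def
  by (intro conjI ballI allI impI assms) (auto dest: assms(5))

text \<open>If \<open>x + y\<close> is a multiple of \<open>g\<close>, expand \<open>x\<close> and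
  \<open>y\<close> in \<open>G\<close>. The joint contribution of the other generators is then a
  multiple of \<open>g\<close>; irredundancy forbids a positive factor and non-negativity makes it
  zero, so \<open>x\<close> and \<open>y\<close> use \<open>g\<close> alone.\<close>

lemma cone_face_irredundant_generator:
  assumes G: "finite G" "g \<in> G" and g: "rat_vec g \<notin> rat_cone (G - {g})"
    and nz: "0 \<notin> G"
  shows "cone_face {c *s rat_vec g | c. 0 \<le> c} (rat_cone G)"
proof -
  let ?F = "{c *s rat_vec g | c. 0 \<le> c}"
  have zero: "0 \<in> ?F" by (auto intro!: exI[of _ 0])
  have cone: "rat_convex_cone (rat_cone G)" by (rule rat_convex_cone_rat_cone)
  have sub: "?F \<subseteq> rat_cone G"
    using cone rat_cone_inc[OF G(2)] by (auto simp: rat_convex_cone_def)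
  have add: "x + y \<in> ?F" if xy: "x \<in> ?F" "y \<in> ?F" for x y
  proof -
    obtain c d where "x = c *s rat_vec g" "y = d *s rat_vec g" "0 \<le> c" "0 \<le> d"
      using xy by auto
    then show ?thesis
      by (auto intro!: exI[of _ "c + d"] simp: vector_sadd_rdistrib)
  qed
  have scale: "a *s x \<in> ?F" if a: "0 \<le> a" and x: "x \<in> ?F" for a x
  proof -
    obtain c where "x = c *s rat_vec g" "0 \<le> c" using x by auto
    then have "a *s x = (a * c) *s rat_vec g" "0 \<le> a * c" using a by simp_all
    then show ?thesis by blast
  qed
  have face: "x \<in> ?F \<and> y \<in> ?F"
    if xy: "x \<in> rat_cone G" "y \<in> rat_cone G" "x + y \<in> ?F" for x y
  proof -
    obtain a where a: "\<forall>s. 0 \<le> a s" "x = (\<Sum>s\<in>G. a s *s rat_vec s)"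
      by (rule rat_cone_finiteE[OF G(1) xy(1)])
    obtain b where b: "\<forall>s. 0 \<le> b s" "y = (\<Sum>s\<in>G. b s *s rat_vec s)"
      by (rule rat_cone_finiteE[OF G(1) xy(2)])
    obtain c where c: "x + y = c *s rat_vec g" using xy(3) by auto
    \<comment> \<open>\<open>r\<close> collects the generators other than \<open>g\<close>;
      \<open>d\<close> is the factor that comparing both expressions for \<open>x + y\<close> forces
      in \<open>r = d *s rat_vec g\<close>.\<close>
    define r where "r = (\<Sum>s\<in>G-{g}. (a s + b s) *s rat_vec s)"
    define d where "d = c - a g - b g"
    have ab0: "0 \<le> a s + b s" for s using a(1) b(1) by (simp add: add_nonneg_nonneg)
    have "x + y = (\<Sum>s\<in>G. (a s + b s) *s rat_vec s)"
      unfolding a(2) b(2) by (simp add: sum.distrib vector_sadd_rdistrib)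
    also have "\<dots> = (a g + b g) *s rat_vec g + r"
      unfolding r_def using G by (rule sum.remove)
    finally have r: "r = d *s rat_vec g"
      unfolding c d_def by (simp add: vec_eq_iff algebra_simps)
    have r_cone: "r \<in> rat_cone (G - {g})"
      unfolding rat_cone_def r_def using G ab0
      by (intro CollectI exI[of _ "G - {g}"] exI[of _ "\<lambda>s. a s + b s"]) auto
    have "d \<le> 0"
    proof (rule ccontr)
      assume "\<not> d \<le> 0"
      then have "rat_vec g = inverse d *s r" "0 \<le> inverse d"
        by (simp_all add: r vector_smult_assoc)
      then show False using g r_cone rat_convex_cone_rat_cone[of "G - {g}"]
        unfolding rat_convex_cone_def by metis
    qed
    have r0: "r $ i = 0" for i
    proof (rule antisym)
      show "r $ i \<le> 0" using \<open>d \<le> 0\<close> by (simp add: r mult_nonpos_nonneg)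
      show "0 \<le> r $ i" using r_cone by (rule rat_cone_nonneg)
    qed
    have ab: "a s = 0 \<and> b s = 0" if s: "s \<in> G - {g}" for s
    proof -
      \<comment> \<open>Here \<open>0 \<notin> G\<close> enters: at a non-zero coordinate of
        \<open>s\<close>, a vanishing sum of non-negative terms forces the coefficient of
        \<open>s\<close> to vanish.\<close>
      obtain i where i: "s $ i \<noteq> 0" using s nz vec_eq_iff[of s 0] by force
      have "(\<Sum>s\<in>G-{g}. (a s + b s) * of_nat (s $ i)) = 0"
        using r0[of i] by (simp add: r_def distrib_right)
      then have "(a s + b s) * of_nat (s $ i) = 0"
        using G(1) s ab0 by (subst (asm) sum_nonneg_eq_0_iff) auto
      then have "a s + b s = 0" using i by simp
      then show ?thesis using a(1) b(1) by (metis add_nonneg_eq_0_iff)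
    qed
    have "x = a g *s rat_vec g" "y = b g *s rat_vec g"
      unfolding a(2) b(2) sum.remove[OF G] using ab by (simp_all)
    then show ?thesis using a(1) b(1) by blast
  qed
  show ?thesis by (rule cone_faceI[OF sub zero add scale face])
qed

text \<open>In an inclusion-minimal finite generating set of the cone, every generator spans an
  extremal ray. The element of \<open>M\<close> on that ray is a positive multiple of the generator,
  which therefore lies in \<open>rat_cone M\<close>.\<close>

lemma rat_cone_eq_if_meets_extremal_rays:
  assumes S: "affine_semigroup S" and M: "M \<subseteq> S"
    and meets: "\<And>\<tau>. \<tau> \<in> extremal_rays S \<Longrightarrow> M \<inter> (\<tau> - {0}) \<noteq> {}"
  shows "rat_cone M = rat_cone S"
proof (rule antisym)
  show "rat_cone M \<subseteq> rat_cone S" using M by (rule rat_cone_mono)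
  obtain G0 where G0: "finite G0" "S = submonoid_pred hull G0"
    using S by (auto simp: affine_semigroup_def)
  define \<G> where "\<G> = {G. G \<subseteq> G0 \<and> rat_cone G = rat_cone S}"
  have "finite \<G>" "G0 \<in> \<G>" using G0 by (auto simp: \<G>_def rat_cone_hull)
  then obtain G where G: "G \<in> \<G>" and min: "\<And>H. H \<in> \<G> \<Longrightarrow> H \<subseteq> G \<Longrightarrow> H = G"
    using finite_has_minimal[of \<G>] by blast
  have fin: "finite G" and cone: "rat_cone G = rat_cone S"
    using G G0 by (auto simp: \<G>_def intro: finite_subset)
  have irr: "rat_vec g \<notin> rat_cone (G - {g})" if g: "g \<in> G" for g
  proof
    assume "rat_vec g \<in> rat_cone (G - {g})"
    then have "rat_cone G \<subseteq> rat_cone (G - {g})"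
      using g by (intro rat_cone_minimal rat_convex_cone_rat_cone) (metis Diff_iff rat_cone_inc singletonD)
    moreover have "rat_cone (G - {g}) \<subseteq> rat_cone G" by (intro rat_cone_mono) auto
    ultimately have "G - {g} \<in> \<G>" using G cone by (auto simp: \<G>_def)
    then show False using min[of "G - {g}"] g by blast
  qed
  \<comment> \<open>Every cone contains \<open>0\<close>, so \<open>0\<close> would be a redundant
    generator.\<close>
  have nz: "0 \<notin> G"
    using irr[of 0] rat_convex_cone_rat_cone[of "G - {0}"] by (auto simp: rat_convex_cone_def)
  have "rat_vec g \<in> rat_cone M" if g: "g \<in> G" for g
  proof -
    define F where "F = {c *s rat_vec g | c. 0 \<le> c}"
    have face: "cone_face F (rat_cone S)"
      using cone_face_irredundant_generator[OF fin g irr[OF g] nz] by (simp add: F_def cone)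
    have "g \<noteq> 0" using g nz by metis
    have "vec.dim F = 1"
    proof (rule vec.dim_unique)
      show "{rat_vec g} \<subseteq> F" by (auto simp: F_def intro!: exI[of _ 1])
      show "F \<subseteq> vec.span {rat_vec g}" by (auto simp: F_def vec.span_singleton)
      show "vec.independent {rat_vec g}" using \<open>g \<noteq> 0\<close> by simp
    qed simp
    with face have "{x. rat_vec x \<in> F} \<in> extremal_rays S" by (auto simp: extremal_rays_def)
    then obtain x where x: "x \<in> M" "rat_vec x \<in> F" "x \<noteq> 0" using meets by blast
    then obtain c where c: "0 \<le> c" "rat_vec x = c *s rat_vec g" by (auto simp: F_def)
    then have "c \<noteq> 0" using x by (metis rat_vec_eq_0_iff vector_smult_lzero)
    then have "rat_vec g = inverse c *s rat_vec x" "0 \<le> inverse c"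
      using c by (simp_all add: vector_smult_assoc)
    then show ?thesis using rat_cone_inc[OF x(1)] rat_convex_cone_rat_cone[of M]
      unfolding rat_convex_cone_def by metis
  qed
  then have "rat_cone G \<subseteq> rat_cone M" by (intro rat_cone_minimal rat_convex_cone_rat_cone)
  then show "rat_cone S \<subseteq> rat_cone M" by (simp add: cone)
qed

section \<open>The semigroup of an ideal generated on the rays\<close>

lemma submonoid_pred_ideal_0:
  assumes "submonoid_pred S" "M \<subseteq> S"
  shows "submonoid_pred ((M + S) \<union> {0})"
  unfolding submonoid_pred_def
proof (intro conjI ballI)
  fix x y assume xy: "x \<in> (M + S) \<union> {0}" "y \<in> (M + S) \<union> {0}"
  show "x + y \<in> (M + S) \<union> {0}"
  proof (cases "x = 0 \<or> y = 0")
    case True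
    then show ?thesis using xy by auto
  next
    case False
    then obtain a s b s' where "x = a + s" "y = b + s'" "a \<in> M" "b \<in> M" "s \<in> S" "s' \<in> S"
      using xy by (auto elim!: set_plus_elim)
    then have "x + y = a + (s + (b + s'))" "s + (b + s') \<in> S"
      using assms by (auto simp: submonoid_pred_def add.assoc)
    then show ?thesis using \<open>a \<in> M\<close> by (metis UnI1 set_plus_intro)
  qed
qed simp

text \<open>If the coefficient of a non-zero generator \<open>g\<close> in an atom exceeded
  \<open>k g\<close>, then \<open>k g *s g\<close> could be split off as an element of
  \<open>T\<close>, leaving a non-zero element of \<open>T\<close>. So atoms come from finitely many
  choices of \<open>m\<close> and bounded coefficients.\<close>

lemma finite_atoms_ideal_0:
  fixes S M :: "(nat ^ 'p::finite) set"
  assumes S: "affine_semigroup S" and M: "M \<subseteq> S" "finite M" "0 \<notin> M"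
    and mult: "\<And>s. s \<in> S \<Longrightarrow> \<exists>k>0. k *s s \<in> (M + S) \<union> {0}"
  shows "finite (atoms ((M + S) \<union> {0}))"
proof -
  let ?T = "(M + S) \<union> {0}"
  obtain G where G: "finite G" "S = submonoid_pred hull G"
    using S by (auto simp: affine_semigroup_def)
  have GS: "G \<subseteq> S" unfolding G(2) by (rule hull_subset)
  have "\<forall>s\<in>S. \<exists>k>0. k *s s \<in> ?T" using mult by blast
  then obtain k where k: "\<And>s. s \<in> S \<Longrightarrow> k s > 0 \<and> k s *s s \<in> ?T" by metis
  define B where "B = Pi\<^sub>E G (\<lambda>g. {..k g})"
  have "finite B" unfolding B_def using G by (intro finite_PiE) auto
  have "atoms ?T \<subseteq> (\<lambda>(m, b). m + (\<Sum>g\<in>G. b g *s g)) ` (M \<times> B)"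
  proof
    fix x assume x: "x \<in> atoms ?T"
    then obtain m s where m: "m \<in> M" "s \<in> S" "x = m + s"
      by (auto simp: atoms_def elim!: set_plus_elim)
    obtain b where b: "s = (\<Sum>g\<in>G. b g *s g)"
      using m(2) unfolding G(2) submonoid_pred_hull_finite[OF G(1)] by blast
    \<comment> \<open>The vector \<open>0\<close> may be one of the generators; its coefficient carries no information.\<close>
    define b' where "b' = restrict (\<lambda>g. if g = 0 then 0 else b g) G"
    have "s = (\<Sum>g\<in>G. b' g *s g)"
      unfolding b b'_def by (rule sum.cong) (auto simp: vec_eq_iff)
    moreover have "b g \<le> k g" if g: "g \<in> G" "g \<noteq> 0" for g
    proof (rule ccontr)
      assume "\<not> b g \<le> k g"
      then have "b g *s g = k g *s g + (b g - k g) *s g"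
        by (simp add: vec_eq_iff flip: add_mult_distrib)
      \<comment> \<open>The summand \<open>m\<close> stays with the remainder; it keeps the
        remainder both inside \<open>M + S\<close> and non-zero.\<close>
      then have "x = k g *s g + (m + ((b g - k g) *s g + (\<Sum>h\<in>G-{g}. b h *s h)))"
        unfolding m b sum.remove[OF G(1) g(1)] by (simp add: ac_simps)
      moreover have "(b g - k g) *s g + (\<Sum>h\<in>G-{g}. b h *s h) \<in> S"
      proof -
        have mS: "submonoid_pred S" using S by (simp add: affine_semigroup_def)
        have "(b g - k g) *s g \<in> S" "(\<Sum>h\<in>G-{g}. b h *s h) \<in> S"
          using GS g by (auto intro!: submonoid_pred_sum submonoid_pred_smult mS)
        then show ?thesis using mS by (simp add: submonoid_pred_def)
      qed
      then have "m + ((b g - k g) *s g + (\<Sum>h\<in>G-{g}. b h *s h)) \<in> ?T"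
        using m by (auto intro: set_plus_intro)
      moreover have "k g *s g \<in> ?T" using k g GS by blast
      moreover have "k g *s g \<noteq> 0"
        using k[of g] g GS by (auto simp: vec_eq_iff)
      moreover have "m + ((b g - k g) *s g + (\<Sum>h\<in>G-{g}. b h *s h)) \<noteq> 0"
        using m M by (auto simp: add_eq_0_vec_iff)
      ultimately show False using x unfolding atoms_def by blast
    qed
    then have "b' \<in> B" by (auto simp: B_def b'_def)
    ultimately show "x \<in> (\<lambda>(m, b). m + (\<Sum>g\<in>G. b g *s g)) ` (M \<times> B)"
      using m by auto
  qed
  then show ?thesis
    using M(2) \<open>finite B\<close> by (meson finite_SigmaI finite_imageI finite_subset)
qed

text \<open>With exactly one element of \<open>M\<close> on each ray, \<open>M\<close> is the set of
  multiplicities of \<open>T\<close>. A non-zero element of \<open>T\<close> is then reducible iff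
  some \<open>m\<close> in \<open>M\<close> can be subtracted with a non-zero result in
  \<open>T\<close>, so the common Apery set consists of \<open>0\<close> and the atoms outside
  \<open>M\<close>.\<close>

lemma MED_semigroup_ideal_0:
  fixes S M T :: "(nat ^ 'p::finite) set"
  assumes S: "affine_semigroup S" and M: "M \<subseteq> S" "finite M" "0 \<notin> M"
    and on_ray: "\<And>m. m \<in> M \<Longrightarrow> \<exists>\<tau>\<in>extremal_rays S. m \<in> \<tau>"
    and ray: "\<And>\<tau>. \<tau> \<in> extremal_rays S \<Longrightarrow> \<exists>m. M \<inter> \<tau> = {m}"
    and T: "T = (M + S) \<union> {0}"
  shows "rat_cone T = rat_cone S" "affine_semigroup T" "MED_semigroup T"
proof -
  have mS: "submonoid_pred S" using S by (simp add: affine_semigroup_def)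
  have zero: "0 \<in> S" and add: "\<And>x y. x \<in> S \<Longrightarrow> y \<in> S \<Longrightarrow> x + y \<in> S"
    using mS by (auto simp: submonoid_pred_def)
  have mT: "submonoid_pred T" unfolding T using mS M(1) by (rule submonoid_pred_ideal_0)
  have TS: "T \<subseteq> S" using M zero add by (auto simp: T elim!: set_plus_elim)
  have MT: "M \<subseteq> T"
  proof
    fix m assume "m \<in> M"
    then have "m + 0 \<in> M + S" using zero by (rule set_plus_intro)
    then show "m \<in> T" by (simp add: T)
  qed
  have cone_M: "rat_cone M = rat_cone S"
  proof (rule rat_cone_eq_if_meets_extremal_rays[OF S M(1)])
    fix \<tau> assume "\<tau> \<in> extremal_rays S"
    then show "M \<inter> (\<tau> - {0}) \<noteq> {}" using ray[of \<tau>] M(3) by blast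
  qed
  show cone: "rat_cone T = rat_cone S"
    using cone_M rat_cone_mono[OF MT] rat_cone_mono[OF TS] by blast
  have rays: "extremal_rays T = extremal_rays S" using cone by (rule extremal_rays_cong)
  have "\<exists>k>0. k *s s \<in> T" if "s \<in> S" for s
  proof -
    have "s \<in> lattice_cone M" using rat_cone_inc[OF that] by (simp add: lattice_cone_def cone_M)
    then obtain k where "k > 0" "k *s s \<in> submonoid_pred hull M" by (rule lattice_cone_multiple)
    moreover have "submonoid_pred hull M \<subseteq> T" using MT mT by (rule hull_minimal)
    ultimately show ?thesis by blast
  qed
  then have "finite (atoms T)"
    using finite_atoms_ideal_0[OF S M] by (simp add: T)
  then show aff: "affine_semigroup T"
    unfolding affine_semigroup_def using mT submonoid_pred_hull_atoms[OF mT] by metis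
  \<comment> \<open>By the face property \<open>a\<close> lies on the same ray as
    \<open>a + s\<close>, and that ray carries only one element of \<open>M\<close>. Minimality and
    irreducibility of \<open>m\<close> both rest on this.\<close>
  have eq_M: "a = m"
    if a: "a \<in> M" and m: "m \<in> M" and s: "s \<in> S"
      and t: "\<tau> \<in> extremal_rays S" "m \<in> \<tau>" "a + s \<in> \<tau>" for a m s \<tau>
  proof -
    have "a \<in> \<tau>" using extremal_rays_addD(1)[OF t(1) _ s t(3)] a M(1) by blast
    moreover obtain m' where "M \<inter> \<tau> = {m'}" using ray[OF t(1)] by blast
    ultimately show "a = m" using a m t(2) by (metis IntI singletonD)
  qed
  have mult: "mult T \<tau> = m" if m: "\<tau> \<in> extremal_rays S" "m \<in> M" "m \<in> \<tau>" for \<tau> m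
    unfolding mult_def
  proof (rule Least_equality)
    show "m \<in> \<tau> \<inter> T - {0}" using m MT M by blast
    fix x assume x: "x \<in> \<tau> \<inter> T - {0}"
    then obtain a s where as: "x = a + s" "a \<in> M" "s \<in> S" by (auto simp: T elim!: set_plus_elim)
    then have "a = m" using eq_M[OF as(2) m(2) as(3) m(1,3)] x by simp
    then show "m \<le> x" by (simp add: as less_eq_vec_def)
  qed
  have E: "mult T ` extremal_rays T = M"
  proof
    show "mult T ` extremal_rays T \<subseteq> M"
    proof (clarsimp simp: rays)
      fix \<tau> assume t: "\<tau> \<in> extremal_rays S"
      then obtain m where "m \<in> M" "m \<in> \<tau>" using ray by blast
      then show "mult T \<tau> \<in> M" using mult[OF t] by simp
    qed
    show "M \<subseteq> mult T ` extremal_rays T"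
      unfolding rays using on_ray mult by (metis image_eqI subsetI)
  qed
  have M_atoms: "M \<subseteq> atoms T"
  proof
    fix m assume m: "m \<in> M"
    obtain \<tau> where t: "\<tau> \<in> extremal_rays S" "m \<in> \<tau>" using on_ray[OF m] by blast
    have "y = 0 \<or> z = 0" if yz: "y \<in> T" "z \<in> T" "m = y + z" for y z
    proof (cases "y = 0")
      case False
      then obtain a s where as: "y = a + s" "a \<in> M" "s \<in> S"
        using yz by (auto simp: T elim!: set_plus_elim)
      \<comment> \<open>Since \<open>z\<close> lies in \<open>S\<close>, it is absorbed into the
        \<open>S\<close>-part, so \<open>a\<close> must be \<open>m\<close> and cancellation gives
        \<open>s + z = 0\<close>.\<close>
      have "m = a + (s + z)" "s + z \<in> S" using as yz TS add by (auto simp: add.assoc)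
      then have "a = m" using eq_M[OF as(2) m _ t] t by simp
      then have "s + z = 0" using \<open>m = a + (s + z)\<close> by simp
      then show ?thesis by (simp add: add_eq_0_vec_iff)
    qed simp
    then show "m \<in> atoms T" using m MT M by (auto simp: atoms_def)
  qed
  have atom_iff: "x \<in> atoms T \<longleftrightarrow> x \<in> T - {0} \<and> (\<forall>m\<in>M. \<forall>u\<in>T - {0}. x \<noteq> u + m)" for x
  proof
    assume "x \<in> atoms T"
    then show "x \<in> T - {0} \<and> (\<forall>m\<in>M. \<forall>u\<in>T - {0}. x \<noteq> u + m)"
      using MT M(3) unfolding atoms_def by blast
  next
    assume x: "x \<in> T - {0} \<and> (\<forall>m\<in>M. \<forall>u\<in>T - {0}. x \<noteq> u + m)"
    have "y = 0 \<or> z = 0" if yz: "y \<in> T" "z \<in> T" "x = y + z" for y z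
    proof (rule ccontr)
      assume nz: "\<not> (y = 0 \<or> z = 0)"
      then obtain a s where as: "y = a + s" "a \<in> M" "s \<in> S"
        using yz by (auto simp: T elim!: set_plus_elim)
      obtain b s' where bs: "z = b + s'" "b \<in> M" "s' \<in> S"
        using yz nz by (auto simp: T elim!: set_plus_elim)
      have "b + (s' + s) \<in> T" using bs as add by (auto simp: T intro: set_plus_intro)
      moreover have "b + (s' + s) \<noteq> 0" using bs M(3) by (metis add_eq_0_vec_iff)
      \<comment> \<open>Moving \<open>s\<close> to the other summand turns an arbitrary
        decomposition into one where the part removed is exactly an element of
        \<open>M\<close>.\<close>
      moreover have "x = (b + (s' + s)) + a" using yz as bs by (simp add: ac_simps)
      ultimately show False using x as(2) by blast
    qed
    then show "x \<in> atoms T" using x by (auto simp: atoms_def)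
  qed
  have "T \<inter> (\<Inter>\<tau>\<in>extremal_rays T. Apery T (mult T \<tau>)) = T \<inter> (\<Inter>m\<in>M. Apery T m)"
    unfolding E[symmetric] by simp
  also have "\<dots> = (atoms T - M) \<union> {0}"
  proof (rule set_eqI)
    fix x
    have "0 \<in> T" using mT by (simp add: submonoid_pred_def)
    show "x \<in> T \<inter> (\<Inter>m\<in>M. Apery T m) \<longleftrightarrow> x \<in> (atoms T - M) \<union> {0}"
    proof (cases "x = 0")
      case True
      have "0 \<noteq> u + m" if "m \<in> M" for u m
        using that M(3) by (metis add_eq_0_vec_iff)
      then show ?thesis using True \<open>0 \<in> T\<close> by (auto simp: Apery_def)
    next
      case False
      \<comment> \<open>The Apery condition also allows \<open>u = 0\<close>, which excludes
        precisely the elements of \<open>M\<close>; the remaining \<open>u\<close> give the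
        condition in \<open>atom_iff\<close>.\<close>
      have T0: "(\<forall>u\<in>T. P u) \<longleftrightarrow> P 0 \<and> (\<forall>u\<in>T - {0}. P u)" for P
        using \<open>0 \<in> T\<close> by blast
      have "x \<in> T \<inter> (\<Inter>m\<in>M. Apery T m) \<longleftrightarrow> x \<in> T \<and> (\<forall>m\<in>M. \<forall>u\<in>T. x \<noteq> u + m)"
        by (auto simp: Apery_def)
      also have "\<dots> \<longleftrightarrow> x \<in> T \<and> x \<notin> M \<and> (\<forall>m\<in>M. \<forall>u\<in>T - {0}. x \<noteq> u + m)"
        by (subst T0) auto
      finally show ?thesis using False unfolding atom_iff Un_iff Diff_iff[of x "atoms T"] by blast
    qed
  qed
  finally have "T \<inter> (\<Inter>\<tau>\<in>extremal_rays T. Apery T (mult T \<tau>)) = (atoms T - M) \<union> {0}" .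
  moreover have "minimally_generated_by T (M \<union> (atoms T - M))"
    using minimally_generated_by_atoms[OF mT] M_atoms by (simp add: Un_absorb1)
  moreover have "0 \<notin> atoms T - M" by (simp add: atoms_def)
  ultimately show "MED_semigroup T"
    unfolding MED_semigroup_def using aff E
    by (intro conjI exI[of _ M] exI[of _ "atoms T - M"]) simp_all
qed

text \<open>The intersection of Apery sets is taken inside \<open>S\<close> to cover
  \<open>t = 0\<close>, where the indexed intersection would be \<open>UNIV\<close>. The last
  conjunct expresses that the union is disjoint.\<close>

theorem lemma20:
  fixes S M T :: "(nat ^ 'p::finite) set"
    and \<tau> :: "nat \<Rightarrow> (nat ^ 'p) set" and m :: "nat \<Rightarrow> nat ^ 'p" and t :: nat
  assumes "affine_semigroup S"
    and "bij_betw \<tau> {1..t} (extremal_rays S)"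
    and "M = m ` {1..t}"
    and "M \<subseteq> S"
    and "\<forall>i\<in>{1..t}. M \<inter> (\<tau> i - {0}) \<noteq> {}"
    and "T = (M + S) \<union> {0}"
  shows "semigroup_ideal (M + S) S \<and> I_semigroup S T \<and> MED_semigroup T \<and>
    gaps T = gaps S \<union> (S \<inter> (\<Inter>i\<in>{1..t}. Apery S (m i)) - {0}) \<and>
    gaps S \<inter> (S \<inter> (\<Inter>i\<in>{1..t}. Apery S (m i)) - {0}) = {}"
proof -
  have zero: "0 \<in> S" and add: "\<And>x y. x \<in> S \<Longrightarrow> y \<in> S \<Longrightarrow> x + y \<in> S"
    using assms(1) by (auto simp: affine_semigroup_def submonoid_pred_def)
  have rays: "extremal_rays S = \<tau> ` {1..t}" and inj: "inj_on \<tau> {1..t}"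
    using assms(2) by (auto simp: bij_betw_def)
  \<comment> \<open>The numbering of \<open>m\<close> need not match that of the rays, so
    \<open>f i\<close> is chosen as an element of \<open>M\<close> on \<open>\<tau> i\<close>; it
    may differ from \<open>m i\<close>.\<close>
  have "\<forall>i\<in>{1..t}. \<exists>a. a \<in> M \<inter> (\<tau> i - {0})" using assms(5) by blast
  from bchoice[OF this] obtain f where f: "\<And>i. i \<in> {1..t} \<Longrightarrow> f i \<in> M \<inter> (\<tau> i - {0})"
    by blast
  have f_ray: "i = j" if "i \<in> {1..t}" "j \<in> {1..t}" "f i \<in> \<tau> j" for i j
  proof -
    have "\<tau> i \<in> extremal_rays S" "\<tau> j \<in> extremal_rays S" using that by (simp_all add: rays)
    then have "\<tau> i = \<tau> j" using f[OF that(1)] that(3) by (intro extremal_rays_unique) auto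
    then show ?thesis by (rule inj_onD[OF inj _ that(1,2)])
  qed
  have fin: "finite M" using assms(3) by simp
  \<comment> \<open>Counting: \<open>M\<close> has at most \<open>t\<close> elements and meets \<open>t\<close> rays that pairwise share only \<open>0\<close>.\<close>
  have M: "M = f ` {1..t}"
  proof (rule sym, rule card_seteq[OF fin])
    show "f ` {1..t} \<subseteq> M" using f by blast
    have "inj_on f {1..t}"
    proof (rule inj_onI)
      fix i j assume "i \<in> {1..t}" "j \<in> {1..t}" "f i = f j"
      then show "i = j" using f_ray[of i j] f[of j] by simp
    qed
    then have "card (f ` {1..t}) = t" by (simp add: card_image)
    moreover have "card M \<le> t" using card_image_le[of "{1..t}" m] assms(3) by simp
    ultimately show "card M \<le> card (f ` {1..t})" by simp
  qed
  have M0: "0 \<notin> M" using M f by force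
  have on_ray: "\<exists>\<sigma>\<in>extremal_rays S. a \<in> \<sigma>" if a: "a \<in> M" for a
  proof -
    obtain i where i: "i \<in> {1..t}" "a = f i" using a unfolding M by blast
    then have "a \<in> \<tau> i" "\<tau> i \<in> extremal_rays S" using f[OF i(1)] by (auto simp: rays)
    then show ?thesis by blast
  qed
  have ray: "\<exists>a. M \<inter> \<sigma> = {a}" if \<sigma>: "\<sigma> \<in> extremal_rays S" for \<sigma>
  proof -
    obtain j where j: "\<sigma> = \<tau> j" "j \<in> {1..t}" using \<sigma> unfolding rays by blast
    have "M \<inter> \<sigma> = {f j}"
    proof (intro equalityI subsetI)
      fix a assume a: "a \<in> M \<inter> \<sigma>"
      then obtain i where i: "a = f i" "i \<in> {1..t}" unfolding M by blast
      then have "i = j" using a j by (intro f_ray) simp_all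
      then show "a \<in> {f j}" using i by simp
    qed (use f[OF j(2)] j(1) in simp)
    then show ?thesis by blast
  qed
  note T = MED_semigroup_ideal_0[OF assms(1) assms(4) fin M0 on_ray ray assms(6)]
  have MS: "M + S \<subseteq> S" using assms(4) add by (auto elim!: set_plus_elim)
  have "M + S + S \<subseteq> M + S"
    using add by (auto elim!: set_plus_elim simp: add.assoc intro!: set_plus_intro)
  then have ideal: "semigroup_ideal (M + S) S"
    using MS by (simp add: semigroup_ideal_def)
  have "0 \<notin> M + S"
  proof
    assume "0 \<in> M + S"
    then obtain a s where "0 = a + s" "a \<in> M" by (auto elim: set_plus_elim)
    then show False using M0 by (metis add_eq_0_vec_iff)
  qed
  then have "T - {0} = M + S" using assms(6) by auto
  then have "I_semigroup S T" using ideal T(2) by (simp add: I_semigroup_def)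
  moreover have "gaps T = gaps S \<union> (S \<inter> (\<Inter>i\<in>{1..t}. Apery S (m i)) - {0})"
  proof -
    \<comment> \<open>Not lying in \<open>M + S\<close> means that no \<open>m i\<close> can be
      subtracted within \<open>S\<close>, so \<open>S - T\<close> is the common Apery set without
      \<open>0\<close>. As \<open>S\<close> and \<open>T\<close> have the same cone, these are the
      only new gaps.\<close>
    have "x \<in> M + S \<longleftrightarrow> (\<exists>i\<in>{1..t}. \<exists>u\<in>S. x = u + m i)" for x
      unfolding set_plus_def assms(3) by (auto simp: add.commute)
    then have "S - T = S \<inter> (\<Inter>i\<in>{1..t}. Apery S (m i)) - {0}"
      by (auto simp: assms(6) Apery_def)
    moreover have "S \<subseteq> lattice_cone S" by (auto simp: lattice_cone_def intro: rat_cone_inc)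
    moreover have "T \<subseteq> S" using MS zero assms(6) by auto
    moreover have "lattice_cone T = lattice_cone S" by (simp add: lattice_cone_def T(1))
    ultimately show ?thesis unfolding gaps_def by blast
  qed
  moreover have "gaps S \<inter> (S \<inter> (\<Inter>i\<in>{1..t}. Apery S (m i)) - {0}) = {}"
    by (auto simp: gaps_def)
  ultimately show ?thesis using ideal T(3) by blast
qed

end
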